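(* Let $A\in\mathbb{R}^{m\times n}$ with $m<n$, let $x\in\mathbb{R}^n$ be a sparse vector supported on $N\subseteq[n]$ with $|N|=s$, and let $y=Ax$. Let $T\subseteq[n]$ with $|T|=k$, let $\Delta_1=T\cap N$ with $|\Delta_1|=t$, and let $\Delta=T^c\cap N$ with $|\Delta|=u$. Let $0\le w\le 1$. If $$\delta_{k+2u+\lceil wt\rceil}<1,$$ then $x$ is the unique minimizer of the problem $$\min_{z\in\mathbb{R}^n}\ \|z\|_{0,w}\quad\text{subject to}\quad Az=y .$$
   Context: Notation: $[n]=\{1,\dots,n\}$; $T^c=[n]\setminus T$; a vector $x$ is supported on $N$ if $x_i=0$ for all $i\notin N$. For $z\in\mathbb{R}^n$, $\|z\|_0=|\{i: z_i\ne 0\}|$, and $z_T$ denotes the restriction of $z$ to the indices in $T$. The weighted 0-norm (with respect to the fixed set $T$ and the weight $w\in[0,1]$) is $\|z\|_{0,w}=w\|z_T\|_0+\|z_{T^c}\|_0$. The $j$-th restricted isometry constant $\delta_j$ of $A$ (for an integer $j<n$) is the smallest real number such that $(1-\delta_j)\|z\|_2^2\le\|Az\|_2^2\le(1+\delta_j)\|z\|_2^2$ for all $z\in\mathbb{R}^n$ with $\|z\|_0\le j$. The hypothesis on $\delta_{k+2u+\lceil wt\rceil}$ is understood to include that this constant is defined, i.e. $k+2u+\lceil wt\rceil<n$. $\lceil\cdot\rceil$ is the ceiling function. *)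

theory Defs
  imports "HOL-Analysis.Analysis"
begin

text \<open>
  Vectors in \<open>\<real>\<^sup>n\<close> have type \<^typ>\<open>real ^ 'n\<close>; the index set \<open>[n]\<close> is the finite type
  \<open>'n\<close> with \<open>n = CARD('n)\<close>.
\<close>

definition supported_on :: "real ^ 'n \<Rightarrow> 'n set \<Rightarrow> bool" where
  "supported_on x N \<longleftrightarrow> (\<forall>i. i \<notin> N \<longrightarrow> x $ i = 0)"

definition l0 :: "real ^ 'n \<Rightarrow> nat" where
  "l0 z = card {i. z $ i \<noteq> 0}"

text \<open>
  The restriction of a vector to the indices in \<open>T\<close> is padded with zeros outside \<open>T\<close>, so that it
  stays in \<^typ>\<open>real ^ 'n\<close>. This does not affect \<^const>\<open>l0\<close>.
\<close>

definition restrict_vec :: "'n set \<Rightarrow> real ^ 'n \<Rightarrow> real ^ 'n" where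
  "restrict_vec T z = (\<chi> i. if i \<in> T then z $ i else 0)"

definition weighted_l0 :: "real \<Rightarrow> 'n set \<Rightarrow> real ^ 'n \<Rightarrow> real" where
  "weighted_l0 w T z = w * real (l0 (restrict_vec T z)) + real (l0 (restrict_vec (- T) z))"

definition rip_bound :: "real ^ 'n ^ 'm \<Rightarrow> nat \<Rightarrow> real \<Rightarrow> bool" where
  "rip_bound A j d \<longleftrightarrow>
     (\<forall>z. l0 z \<le> j \<longrightarrow>
        (1 - d) * (norm z)\<^sup>2 \<le> (norm (A *v z))\<^sup>2 \<and>
        (norm (A *v z))\<^sup>2 \<le> (1 + d) * (norm z)\<^sup>2)"

definition restricted_isometry_const :: "real ^ 'n ^ 'm \<Rightarrow> nat \<Rightarrow> real" where
  "restricted_isometry_const A j = (LEAST d. rip_bound A j d)"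

text \<open>
  For \<open>j \<ge> 1\<close> the smallest bound exists. For \<open>j = 0\<close> every real number is a bound, so there is no
  smallest one and the value of \<^term>\<open>restricted_isometry_const A 0\<close> is unspecified.
\<close>

lemma restricted_isometry_const_least:
  fixes A :: "real ^ 'n ^ 'm"
  assumes "j \<ge> 1"
  shows "rip_bound A j (restricted_isometry_const A j)"
    and "rip_bound A j d \<Longrightarrow> restricted_isometry_const A j \<le> d"
proof -
  let ?S = "{d. rip_bound A j d}"
  obtain B where B: "\<And>z. norm (A *v z) \<le> B * norm z" "B > 0"
    using bounded_linear.pos_bounded[OF matrix_vector_mul_bounded_linear[of A]]
    by (auto simp: mult.commute)
  have "rip_bound A j (max 1 (B\<^sup>2))"
    unfolding rip_bound_def
  proof (intro allI impI conjI)
    fix z :: "real ^ 'n"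
    have "(1 - max 1 (B\<^sup>2)) * (norm z)\<^sup>2 \<le> 0"
      by (intro mult_nonpos_nonneg) auto
    then show "(1 - max 1 (B\<^sup>2)) * (norm z)\<^sup>2 \<le> (norm (A *v z))\<^sup>2"
      by (rule order_trans) simp
    have "(norm (A *v z))\<^sup>2 \<le> (B * norm z)\<^sup>2"
      by (intro power_mono B) auto
    also have "\<dots> \<le> (1 + max 1 (B\<^sup>2)) * (norm z)\<^sup>2"
      by (auto simp: power_mult_distrib intro!: mult_right_mono)
    finally show "(norm (A *v z))\<^sup>2 \<le> (1 + max 1 (B\<^sup>2)) * (norm z)\<^sup>2" .
  qed
  then have ne: "?S \<noteq> {}" by blast
  define e :: "real ^ 'n" where "e = axis undefined 1"
  have "{i. e $ i \<noteq> 0} = {undefined}" by (auto simp: e_def axis_def)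
  then have e: "l0 e \<le> j" "norm e = 1"
    using assms by (auto simp: l0_def e_def)
  have lb: "0 \<le> d" if "rip_bound A j d" for d
    using that e unfolding rip_bound_def by (force dest: spec[of _ e])
  then have bdd: "bdd_below ?S" by (intro bdd_belowI[of _ 0]) simp
  have "closed ?S"
    unfolding rip_bound_def
    by (intro closed_Collect_all closed_Collect_imp closed_Collect_conj closed_Collect_le
        continuous_intros) auto
  then have "Inf ?S \<in> ?S"
    using closed_contains_Inf[OF ne bdd] by blast
  then have eq: "restricted_isometry_const A j = Inf ?S"
    unfolding restricted_isometry_const_def
    by (intro Least_equality) (auto intro: cInf_lower[OF _ bdd])
  show "rip_bound A j (restricted_isometry_const A j)"
    using \<open>Inf ?S \<in> ?S\<close> eq by simp
  show "rip_bound A j d \<Longrightarrow> restricted_isometry_const A j \<le> d"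
    unfolding eq by (auto intro: cInf_lower[OF _ bdd])
qed

end

theory Submission
  imports Defs
begin

text \<open>
  If \<open>z\<close> is feasible and its weighted 0-norm is at most that of \<open>x\<close>, which is at most \<open>w t + u\<close>,
  then \<open>z\<close> has at most \<open>\<lfloor>w t\<rfloor> + u\<close> nonzero entries outside \<open>T\<close>. Hence \<open>z - x\<close> is a kernel vector
  of \<open>A\<close> with at most \<open>k + (\<lfloor>w t\<rfloor> + u) + u\<close> nonzero entries, and the restricted isometry property
  with constant below 1 forces \<open>z = x\<close>.
\<close>

lemma l0_eq_0_iff: "l0 z = 0 \<longleftrightarrow> z = 0"
  by (auto simp: l0_def vec_eq_iff)

lemma l0_restrict_vec: "l0 (restrict_vec S z) = card {i \<in> S. z $ i \<noteq> 0}"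
  unfolding l0_def restrict_vec_def by (rule arg_cong[where f = card]) auto

lemma sparse_kernel_eq_0:
  fixes A :: "real ^ 'n ^ 'm"
  assumes "restricted_isometry_const A j < 1" "l0 h \<le> j" "A *v h = 0"
  shows "h = 0"
proof (cases "j = 0")
  case True \<comment> \<open>the restricted isometry constant of order 0 is a junk value\<close>
  then show ?thesis using assms(2) by (simp add: l0_eq_0_iff)
next
  case False
  then have "rip_bound A j (restricted_isometry_const A j)"
    by (intro restricted_isometry_const_least) simp
  then have "(1 - restricted_isometry_const A j) * (norm h)\<^sup>2 \<le> 0"
    using assms(2,3) by (auto simp: rip_bound_def dest!: spec[of _ h])
  then show ?thesis
    using assms(1) by (auto simp: mult_le_0_iff)
qed

text \<open>All of \<open>T\<close> is charged once, since entries of \<open>z\<close> there are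
  cheap or free in the weighted norm; only outside \<open>T\<close> are the two supports
  counted.\<close>

lemma l0_diff_le:
  fixes x z :: "real ^ 'n"
  shows "l0 (z - x) \<le> card T + l0 (restrict_vec (- T) z) + l0 (restrict_vec (- T) x)"
proof -
  have "l0 (z - x) \<le> card (T \<union> {i \<in> - T. z $ i \<noteq> 0} \<union> {i \<in> - T. x $ i \<noteq> 0})"
    unfolding l0_def by (intro card_mono) auto
  also have "\<dots> \<le> card T + card {i \<in> - T. z $ i \<noteq> 0} + card {i \<in> - T. x $ i \<noteq> 0}"
    by (intro order_trans[OF card_Un_le] add_right_mono card_Un_le)
  finally show ?thesis by (simp add: l0_restrict_vec)
qed

lemma l0_restrict_vec_le:
  assumes "supported_on x N"
  shows "l0 (restrict_vec S x) \<le> card (S \<inter> N)"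
  unfolding l0_restrict_vec using assms
  by (intro card_mono) (auto simp: supported_on_def)

theorem theorem7:
  fixes A :: "real ^ 'n ^ 'm"
    and x :: "real ^ 'n" and y :: "real ^ 'm"
    and N T \<Delta>\<^sub>1 \<Delta> :: "'n set"
    and s k t u :: nat and w :: real
  assumes "CARD('m) < CARD('n)"
    and "supported_on x N" and "card N = s"
    and "y = A *v x"
    and "card T = k"
    and "\<Delta>\<^sub>1 = T \<inter> N" and "card \<Delta>\<^sub>1 = t"
    and "\<Delta> = - T \<inter> N" and "card \<Delta> = u"
    and "0 \<le> w" and "w \<le> 1"
    and "k + 2 * u + nat \<lceil>w * real t\<rceil> < CARD('n)"
    and "restricted_isometry_const A (k + 2 * u + nat \<lceil>w * real t\<rceil>) < 1"
  shows "is_arg_min (weighted_l0 w T) (\<lambda>z. A *v z = y) x \<and>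
         (\<forall>z. is_arg_min (weighted_l0 w T) (\<lambda>z. A *v z = y) z \<longrightarrow> z = x)"
proof -
  have xT: "l0 (restrict_vec T x) \<le> t" and xTc: "l0 (restrict_vec (- T) x) \<le> u"
    using l0_restrict_vec_le[OF assms(2)] assms(6-9) by metis+
  \<comment> \<open>The non-strict inequality covers ties, so this claim yields both minimality and
    uniqueness.\<close>
  have eq: "z = x" if z: "A *v z = y" "weighted_l0 w T z \<le> weighted_l0 w T x" for z
  proof -
    have "real (l0 (restrict_vec (- T) z)) \<le> weighted_l0 w T z"
      using assms(10) by (simp add: weighted_l0_def)
    also have "\<dots> \<le> weighted_l0 w T x" by (fact z(2))
    also have "\<dots> \<le> w * real t + real u"
      unfolding weighted_l0_def using xT xTc assms(10)
      by (intro add_mono mult_left_mono) auto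
    \<comment> \<open>The left side is an integer and \<open>u\<close> is a natural number, so only
      \<open>w * t\<close> gets rounded.\<close>
    finally have "l0 (restrict_vec (- T) z) \<le> nat \<lceil>w * real t\<rceil> + u"
      by linarith
    then have "l0 (z - x) \<le> k + 2 * u + nat \<lceil>w * real t\<rceil>"
      using l0_diff_le[of z x T] xTc assms(5) by linarith
    moreover have "A *v (z - x) = 0"
      using z(1) assms(4) by (simp add: matrix_vector_mult_diff_distrib)
    ultimately have "z - x = 0"
      by (rule sparse_kernel_eq_0[OF assms(13)])
    then show "z = x" by simp
  qed
  have feasible: "A *v x = y" using assms(4) by simp
  have "is_arg_min (weighted_l0 w T) (\<lambda>z. A *v z = y) x"
    using feasible eq unfolding is_arg_min_def by (metis less_imp_le less_irrefl)
  \<comment> \<open>The feasible point \<open>x\<close> cannot beat a minimizer \<open>z\<close>, so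
    \<open>eq\<close> applies to \<open>z\<close>.\<close>
  moreover have "z = x" if "is_arg_min (weighted_l0 w T) (\<lambda>z. A *v z = y) z" for z
    using that feasible eq unfolding is_arg_min_def by (metis not_less)
  ultimately show ?thesis by blast
qed

end
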